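(* Let $R$ be a ring with a nice topology. Assume that the right regular module $R_R$ has the $(C_2)$ property and that $R$ is Dedekind-finite and semi-$\pi$-regular. Then $R$ is a full exchange ring.
   Context: $R$ is Dedekind-finite if $xy=1$ implies $yx=1$. $R$ is $\pi$-regular if for each $x\in R$ there are $n\ge1$ and $y\in R$ with $x^n=x^nyx^n$; $R$ is semi-$\pi$-regular if $R/J(R)$ is $\pi$-regular and idempotents lift modulo the Jacobson radical $J(R)$. A module $M$ has $(C_2)$ if every submodule of $M$ isomorphic to a direct summand of $M$ is itself a direct summand of $M$. A linear Hausdorff topology on $R$ is a ring topology with a basis $\mathfrak U$ of neighborhoods of $0$ consisting of left ideals, with $\bigcap_{U\in\mathfrak U}U=0$. A family $\{x_i\}_{i\in I}\subseteq R$ is summable to $r$ if for every $U\in\mathfrak U$ there is a finite $F'\subseteq I$ with $\sum_{i\in F}x_i-r\in U$ for all finite $F$ with $F'\subseteq F\subseteq I$ (write $\sum_{i\in I}x_i=r$; the family is then called summable). The topology is nice if it is linear, Hausdorff, and for every summable family $\{x_i\}_{i\in I}$ and every family $\{r_i\}_{i\in I}\subseteq R$ the family $\{r_ix_i\}_{i\in I}$ is summable. For a cardinal $\aleph$, $R$ is an $\aleph$-exchange ring if for every family $\{x_i\}_{i\in I}$ with $|I|\le\aleph$ summable to $1$ there exist pairwise orthogonal idempotents $e_i\in Rx_i$ forming a summable family with $\sum_{i\in I}e_i=1$; $R$ is a full exchange ring if it is an $\aleph$-exchange ring for every cardinal $\aleph$. *)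

theory Defs
  imports Main
begin

definition left_ideal :: "'a::ring_1 set \<Rightarrow> bool" where
  "left_ideal L \<longleftrightarrow> 0 \<in> L \<and> (\<forall>x\<in>L. \<forall>y\<in>L. x + y \<in> L) \<and> (\<forall>x\<in>L. - x \<in> L)
     \<and> (\<forall>r x. x \<in> L \<longrightarrow> r * x \<in> L)"

definition right_ideal :: "'a::ring_1 set \<Rightarrow> bool" where
  "right_ideal L \<longleftrightarrow> 0 \<in> L \<and> (\<forall>x\<in>L. \<forall>y\<in>L. x + y \<in> L) \<and> (\<forall>x\<in>L. - x \<in> L)
     \<and> (\<forall>r x. x \<in> L \<longrightarrow> x * r \<in> L)"

definition maximal_left_ideal :: "'a::ring_1 set \<Rightarrow> bool" where
  "maximal_left_ideal M \<longleftrightarrow> left_ideal M \<and> M \<noteq> UNIV \<and>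
     (\<forall>L. left_ideal L \<and> M \<subseteq> L \<longrightarrow> L = M \<or> L = UNIV)"

definition jacobson :: "'a::ring_1 set" where
  "jacobson = \<Inter>{M. maximal_left_ideal M}"

definition dedekind_finite :: "'a::ring_1 itself \<Rightarrow> bool" where
  "dedekind_finite _ \<longleftrightarrow> (\<forall>x y::'a. x * y = 1 \<longrightarrow> y * x = 1)"

text \<open>Semi-pi-regular: R/J(R) is pi-regular (stated on representatives modulo J(R))
  and idempotents lift modulo J(R).\<close>
definition semi_pi_regular :: "'a::ring_1 itself \<Rightarrow> bool" where
  "semi_pi_regular _ \<longleftrightarrow>
     (\<forall>x::'a. \<exists>n\<ge>1. \<exists>y. x ^ n - x ^ n * y * x ^ n \<in> jacobson) \<and>
     (\<forall>x::'a. x * x - x \<in> jacobson \<longrightarrow> (\<exists>e. e * e = e \<and> e - x \<in> jacobson))"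

text \<open>Submodules of the right regular module R_R are right ideals.\<close>
definition direct_summand_RR :: "'a::ring_1 set \<Rightarrow> bool" where
  "direct_summand_RR S \<longleftrightarrow> right_ideal S \<and>
     (\<exists>K. right_ideal K \<and> S \<inter> K = {0} \<and> (\<forall>z. \<exists>s\<in>S. \<exists>k\<in>K. z = s + k))"

definition right_module_iso :: "('a::ring_1 \<Rightarrow> 'a) \<Rightarrow> 'a set \<Rightarrow> 'a set \<Rightarrow> bool" where
  "right_module_iso f N S \<longleftrightarrow> bij_betw f N S \<and>
     (\<forall>x\<in>N. \<forall>y\<in>N. f (x + y) = f x + f y) \<and>
     (\<forall>x\<in>N. \<forall>r. f (x * r) = f x * r)"

definition C2_RR :: "'a::ring_1 itself \<Rightarrow> bool" where
  "C2_RR _ \<longleftrightarrow> (\<forall>N S :: 'a set. right_ideal N \<and> direct_summand_RR S \<and>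
     (\<exists>f. right_module_iso f N S) \<longrightarrow> direct_summand_RR N)"

text \<open>A linear Hausdorff topology, given by its basis U of neighbourhoods of 0
  consisting of left ideals. The conditions (filter base of left ideals, and for each
  U and r some V with V r \<subseteq> U) are exactly those making the topology a ring topology.\<close>
definition linear_hausdorff_basis :: "'a::ring_1 set set \<Rightarrow> bool" where
  "linear_hausdorff_basis \<U> \<longleftrightarrow>
     \<U> \<noteq> {} \<and> (\<forall>U\<in>\<U>. left_ideal U) \<and>
     (\<forall>U\<in>\<U>. \<forall>V\<in>\<U>. \<exists>W\<in>\<U>. W \<subseteq> U \<inter> V) \<and>
     (\<forall>U\<in>\<U>. \<forall>r. \<exists>V\<in>\<U>. \<forall>v\<in>V. v * r \<in> U) \<and>
     \<Inter>\<U> = {0}"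

definition sums_to :: "'a::ring_1 set set \<Rightarrow> 'i set \<Rightarrow> ('i \<Rightarrow> 'a) \<Rightarrow> 'a \<Rightarrow> bool" where
  "sums_to \<U> I x r \<longleftrightarrow> (\<forall>U\<in>\<U>. \<exists>F'. finite F' \<and> F' \<subseteq> I \<and>
      (\<forall>F. finite F \<and> F' \<subseteq> F \<and> F \<subseteq> I \<longrightarrow> sum x F - r \<in> U))"

definition summable_fam :: "'a::ring_1 set set \<Rightarrow> 'i set \<Rightarrow> ('i \<Rightarrow> 'a) \<Rightarrow> bool" where
  "summable_fam \<U> I x \<longleftrightarrow> (\<exists>r. sums_to \<U> I x r)"

definition nice_topology :: "'a::ring_1 set set \<Rightarrow> 'i itself \<Rightarrow> bool" where
  "nice_topology \<U> _ \<longleftrightarrow> linear_hausdorff_basis \<U> \<and>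
     (\<forall>(I::'i set) x rr. summable_fam \<U> I x \<longrightarrow> summable_fam \<U> I (\<lambda>i. rr i * x i))"

definition exchange_for :: "'a::ring_1 set set \<Rightarrow> 'i set \<Rightarrow> bool" where
  "exchange_for \<U> I \<longleftrightarrow> (\<forall>x. sums_to \<U> I x 1 \<longrightarrow>
     (\<exists>e. (\<forall>i\<in>I. e i * e i = e i \<and> (\<exists>r. e i = r * x i)) \<and>
          (\<forall>i\<in>I. \<forall>j\<in>I. i \<noteq> j \<longrightarrow> e i * e j = 0) \<and>
          sums_to \<U> I e 1))"

text \<open>Full exchange ring: exchange for index sets of every cardinality; an index type
  variable 'i, universally quantified at theorem level, ranges over all sizes.\<close>
definition full_exchange :: "'a::ring_1 set set \<Rightarrow> 'i itself \<Rightarrow> bool" where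
  "full_exchange \<U> _ \<longleftrightarrow> (\<forall>I::'i set. exchange_for \<U> I)"

end

theory Submission
  imports Defs
begin

text \<open>
  Well-order the index set and choose recursively idempotents \<open>e\<^sub>i \<in> R x\<^sub>i\<close> with \<open>e\<^sub>j e\<^sub>i = 0\<close> for
  \<open>j < i\<close>. Such a triangular family has a sum \<open>u\<close> with \<open>ker u = \<Inter>\<^sub>i ker e\<^sub>i\<close>, and, since \<open>J\<close> is
  closed, \<open>ker u\<^sup>2 = ker u\<close> also modulo \<open>J\<close>; semi-\<open>\<pi>\<close>-regularity and Dedekind-finiteness then make
  \<open>ker u\<close> a direct summand \<open>p R\<close>. The tail \<open>\<Sum>k\<ge>i. x\<^sub>k\<close> acts injectively on the common kernel \<open>p R\<close>
  of the earlier idempotents, hence split injectively by \<open>(C\<^sub>2)\<close>: \<open>p = c (\<Sum>k\<ge>i. x\<^sub>k) p\<close>.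
  The next idempotent is found in the corner \<open>p R p\<close> from \<open>a = c x\<^sub>i p\<close>; it only has to detect the
  fixed points of \<open>a\<close> to keep the following tail injective. At limits the basis consists of
  left ideals, so the left inverses \<open>c\<close>, which vary with the stage, cannot spoil convergence.
  At the end the tail is \<open>0\<close>, so \<open>ker u = 0\<close>, \<open>u\<close> is a unit, and the \<open>u\<^sup>-\<^sup>1 e\<^sub>i\<close> are the
  required orthogonal idempotents.
\<close>

section \<open>The Jacobson radical\<close>

lemma left_ideal_zero: "left_ideal L \<Longrightarrow> 0 \<in> L"
  and left_ideal_add: "left_ideal L \<Longrightarrow> x \<in> L \<Longrightarrow> y \<in> L \<Longrightarrow> x + y \<in> L"
  and left_ideal_uminus: "left_ideal L \<Longrightarrow> x \<in> L \<Longrightarrow> - x \<in> L"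
  and left_ideal_mult: "left_ideal L \<Longrightarrow> x \<in> L \<Longrightarrow> r * x \<in> L"
  by (auto simp: left_ideal_def)

lemma left_ideal_diff: "left_ideal L \<Longrightarrow> x \<in> L \<Longrightarrow> y \<in> L \<Longrightarrow> x - y \<in> L"
  using left_ideal_add[of L x "- y"] left_ideal_uminus[of L y] by simp

lemma left_ideal_diff_swap: "left_ideal L \<Longrightarrow> x - y \<in> L \<Longrightarrow> y - x \<in> L"
  using left_ideal_uminus[of L "x - y"] by simp

lemma left_ideal_sum:
  assumes "left_ideal L" and "\<And>i. i \<in> F \<Longrightarrow> x i \<in> L"
  shows "sum x F \<in> L"
  using assms(2)
  by (induction F rule: infinite_finite_induct)
    (auto intro: left_ideal_zero left_ideal_add assms(1))

lemma left_ideal_mult_right: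
  assumes "left_ideal L"
  shows "left_ideal {l * m | l. l \<in> L}" (is "left_ideal ?K")
  unfolding left_ideal_def
proof (intro conjI ballI allI impI)
  show "0 \<in> ?K"
    using left_ideal_zero[OF assms] by (intro CollectI exI[of _ 0]) auto
next
  fix y z assume "y \<in> ?K" "z \<in> ?K"
  then obtain l l' where "y = l * m" "z = l' * m" "l \<in> L" "l' \<in> L" by blast
  then have "y + z = (l + l') * m" "l + l' \<in> L"
    using left_ideal_add[OF assms] by (auto simp: algebra_simps)
  then show "y + z \<in> ?K" by blast
next
  fix y assume "y \<in> ?K"
  then obtain l where "y = l * m" "l \<in> L" by blast
  then have "- y = (- l) * m" "- l \<in> L"
    using left_ideal_uminus[OF assms] by auto
  then show "- y \<in> ?K" by blast
next
  fix q y assume "y \<in> ?K"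
  then obtain l where "y = l * m" "l \<in> L" by blast
  then have "q * y = (q * l) * m" "q * l \<in> L"
    using left_ideal_mult[OF assms] by (auto simp: mult.assoc)
  then show "q * y \<in> ?K" by blast
qed

lemma left_ideal_principal_sum:
  assumes "left_ideal L"
  shows "left_ideal {r * x + l | r l. l \<in> L}" (is "left_ideal ?K")
  unfolding left_ideal_def
proof (intro conjI ballI allI impI)
  show "0 \<in> ?K"
    using left_ideal_zero[OF assms] by (intro CollectI exI[of _ 0]) auto
next
  fix y z assume "y \<in> ?K" "z \<in> ?K"
  then obtain r l r' l' where "y = r * x + l" "z = r' * x + l'" "l \<in> L" "l' \<in> L" by blast
  then have "y + z = (r + r') * x + (l + l')" "l + l' \<in> L"
    using left_ideal_add[OF assms] by (auto simp: algebra_simps)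
  then show "y + z \<in> ?K" by blast
next
  fix y assume "y \<in> ?K"
  then obtain r l where "y = r * x + l" "l \<in> L" by blast
  then have "- y = (- r) * x + (- l)" "- l \<in> L"
    using left_ideal_uminus[OF assms] by auto
  then show "- y \<in> ?K" by blast
next
  fix q y assume "y \<in> ?K"
  then obtain r l where "y = r * x + l" "l \<in> L" by blast
  then have "q * y = (q * r) * x + q * l" "q * l \<in> L"
    using left_ideal_mult[OF assms] by (auto simp: algebra_simps)
  then show "q * y \<in> ?K" by blast
qed

text \<open>Zorn's lemma applies because properness amounts to omitting \<open>1\<close>, a
  condition that unions of chains inherit.\<close>

lemma proper_left_ideal_in_maximal:
  fixes L :: "'a::ring_1 set"
  assumes L: "left_ideal L" and "1 \<notin> L"
  obtains M where "maximal_left_ideal M" and "L \<subseteq> M"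
proof -
  define A where "A = {K. left_ideal K \<and> L \<subseteq> K \<and> 1 \<notin> K}"
  have "\<exists>M\<in>A. \<forall>X\<in>A. M \<subseteq> X \<longrightarrow> X = M"
  proof (rule subset_Zorn_nonempty)
    show "A \<noteq> {}" using assms by (auto simp: A_def)
  next
    fix C assume C: "C \<noteq> {}" "subset.chain A C"
    have sub: "C \<subseteq> A" and tot: "\<And>X Y. X \<in> C \<Longrightarrow> Y \<in> C \<Longrightarrow> X \<subseteq> Y \<or> Y \<subseteq> X"
      using C(2) by (auto simp: subset_chain_def)
    have id: "left_ideal K" if "K \<in> C" for K using that sub by (auto simp: A_def)
    have "left_ideal (\<Union>C)"
      unfolding left_ideal_def
    proof (intro conjI ballI allI impI)
      show "0 \<in> \<Union>C" using C(1) id left_ideal_zero by blast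
    next
      fix x y assume "x \<in> \<Union>C" "y \<in> \<Union>C"
      then obtain X Y where X: "X \<in> C" "Y \<in> C" "x \<in> X" "y \<in> Y" by blast
      then have "x + y \<in> X \<or> x + y \<in> Y"
        using tot[OF X(1,2)] left_ideal_add id by blast
      then show "x + y \<in> \<Union>C" using X by blast
    next
      fix x assume "x \<in> \<Union>C"
      then show "- x \<in> \<Union>C" using id left_ideal_uminus by blast
    next
      fix r x assume "x \<in> \<Union>C"
      then show "r * x \<in> \<Union>C" using id left_ideal_mult by blast
    qed
    then show "\<Union>C \<in> A" using C(1) sub by (auto simp: A_def)
  qed
  then obtain M where M: "M \<in> A" "\<And>X. X \<in> A \<Longrightarrow> M \<subseteq> X \<Longrightarrow> X = M" by blast
  have "maximal_left_ideal M"
    unfolding maximal_left_ideal_def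
  proof (intro conjI allI impI)
    show "left_ideal M" "M \<noteq> UNIV" using M(1) by (auto simp: A_def)
  next
    fix K assume K: "left_ideal K \<and> M \<subseteq> K"
    show "K = M \<or> K = UNIV"
    proof (cases "1 \<in> K")
      case True
      then have "r \<in> K" for r using K left_ideal_mult[of K 1 r] by simp
      then show ?thesis by blast
    next
      case False
      then have "K \<in> A" using K M(1) by (auto simp: A_def)
      then show ?thesis using M(2) K by blast
    qed
  qed
  then show ?thesis using that M(1) by (auto simp: A_def)
qed

lemma left_ideal_jacobson: "left_ideal (jacobson :: 'a::ring_1 set)"
proof -
  have "left_ideal M" if "maximal_left_ideal M" for M :: "'a set"
    using that by (simp add: maximal_left_ideal_def)
  then show ?thesis
    unfolding jacobson_def left_ideal_def[of "\<Inter>_"]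
    by (simp add: left_ideal_zero left_ideal_add left_ideal_uminus left_ideal_mult)
qed

text \<open>If \<open>1 - r * x\<close> had no left inverse, the left ideal it generates would lie
  in a maximal one, which contains \<open>x\<close> and hence \<open>1\<close>. Conversely, a
  maximal \<open>M\<close> omitting \<open>x\<close> satisfies \<open>R x + M = R\<close>, so some
  \<open>1 - r * x\<close> lies in \<open>M\<close> and cannot be left invertible.\<close>

lemma jacobson_iff_left_invertible:
  fixes x :: "'a::ring_1"
  shows "x \<in> jacobson \<longleftrightarrow> (\<forall>r. \<exists>s. s * (1 - r * x) = 1)"
proof
  assume x: "x \<in> jacobson"
  show "\<forall>r. \<exists>s. s * (1 - r * x) = 1"
  proof (rule allI, rule ccontr)
    fix r assume no: "\<nexists>s. s * (1 - r * x) = 1"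
    let ?L = "{s * (1 - r * x) + l | s l. l \<in> {0}}"
    have "left_ideal ?L" by (rule left_ideal_principal_sum) (auto simp: left_ideal_def)
    moreover have "1 \<notin> ?L"
    proof
      assume "1 \<in> ?L"
      then obtain s where "1 = s * (1 - r * x) + 0" by blast
      then show False using no by (metis add.right_neutral)
    qed
    ultimately obtain M where M: "maximal_left_ideal M" "?L \<subseteq> M"
      by (rule proper_left_ideal_in_maximal)
    have li: "left_ideal M" using M(1) by (auto simp: maximal_left_ideal_def)
    have "1 * (1 - r * x) + 0 \<in> M" using M(2) by blast
    moreover have "r * x \<in> M"
      using x M(1) li by (auto simp: jacobson_def intro: left_ideal_mult)
    ultimately have "1 \<in> M" using left_ideal_add[OF li, of "1 - r * x" "r * x"] by simp
    then have "q \<in> M" for q using left_ideal_mult[OF li, of 1 q] by simp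
    then show False using M(1) by (auto simp: maximal_left_ideal_def)
  qed
next
  assume inv: "\<forall>r. \<exists>s. s * (1 - r * x) = 1"
  have "x \<in> M" if M: "maximal_left_ideal M" for M
  proof (rule ccontr)
    assume "x \<notin> M"
    have li: "left_ideal M" using M by (auto simp: maximal_left_ideal_def)
    define K where "K = {r * x + l | r l. l \<in> M}"
    have "left_ideal K" unfolding K_def using li by (rule left_ideal_principal_sum)
    moreover have "M \<subseteq> K"
    proof
      fix m assume "m \<in> M"
      then have "m = 0 * x + m" "m \<in> M" by auto
      then show "m \<in> K" unfolding K_def by blast
    qed
    ultimately have "K = M \<or> K = UNIV" using M by (simp add: maximal_left_ideal_def)
    moreover have "x \<in> K"
    proof -
      have "x = 1 * x + 0" by simp
      then show ?thesis using left_ideal_zero[OF li] unfolding K_def by blast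
    qed
    ultimately have "1 \<in> K" using \<open>x \<notin> M\<close> by auto
    then obtain r m where "1 = r * x + m" "m \<in> M" unfolding K_def by blast
    then have m: "1 - r * x \<in> M" by (metis add_diff_cancel_left')
    obtain s where "s * (1 - r * x) = 1" using inv by blast
    then have "1 \<in> M" using left_ideal_mult[OF li m, of s] by simp
    then have "q \<in> M" for q using left_ideal_mult[OF li, of 1 q] by simp
    then show False using M by (auto simp: maximal_left_ideal_def)
  qed
  then show "x \<in> jacobson" by (auto simp: jacobson_def)
qed

lemma jacobson_mult_left: "x \<in> jacobson \<Longrightarrow> r * x \<in> jacobson"
  by (rule left_ideal_mult[OF left_ideal_jacobson])

lemma jacobson_mult_right:
  fixes x :: "'a::ring_1"
  assumes "x \<in> jacobson"
  shows "x * r \<in> jacobson"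
  unfolding jacobson_iff_left_invertible
proof
  fix q
  obtain c where c: "c * (1 - (r * q) * x) = 1"
    using assms unfolding jacobson_iff_left_invertible by blast
  \<comment> \<open>The left inverse \<open>1 + q * x * c * r\<close> comes from expanding a formal
    geometric series for \<open>1 - q * x * r\<close> and regrouping its factors around
    \<open>r * q * x\<close>.\<close>
  have "(1 + q * x * c * r) * (1 - q * (x * r))
      = 1 - q * x * r + q * x * (c * (1 - (r * q) * x)) * r"
    by (simp add: algebra_simps)
  then have "(1 + q * x * c * r) * (1 - q * (x * r)) = 1" unfolding c by simp
  then show "\<exists>s. s * (1 - q * (x * r)) = 1" by blast
qed

text \<open>The left inverse satisfies \<open>w - 1 = w * j\<close>, which lies in \<open>J\<close>;
  hence \<open>w\<close> has a left inverse too, and that must be \<open>1 - j\<close>.\<close>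

lemma jacobson_one_minus_unit:
  fixes j :: "'a::ring_1"
  assumes "j \<in> jacobson"
  obtains w where "w * (1 - j) = 1" and "(1 - j) * w = 1" and "w - 1 \<in> jacobson"
proof -
  obtain w where w: "w * (1 - j) = 1"
    using assms jacobson_iff_left_invertible[of j] by (metis mult_1)
  then have w1: "w - 1 = w * j" by (simp add: algebra_simps)
  then have wj: "w - 1 \<in> jacobson" using assms by (simp add: jacobson_mult_left)
  then obtain s where "s * (1 - (- 1) * (w - 1)) = 1"
    using jacobson_iff_left_invertible[of "w - 1"] by blast
  then have s: "s * w = 1" by simp
  have "s = s * (w * (1 - j))" by (simp add: w)
  also have "\<dots> = 1 - j" by (simp add: mult.assoc[symmetric] s)
  finally have "(1 - j) * w = 1" using s by simp
  then show ?thesis using that w wj by blast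
qed

lemma jacobson_fixed_eq_zero:
  fixes z :: "'a::ring_1"
  assumes "j \<in> jacobson" and "j * z = z"
  shows "z = 0"
proof -
  obtain w where w: "w * (1 - j) = 1" using jacobson_one_minus_unit[OF assms(1)] by blast
  have "z = w * (1 - j) * z" by (simp add: w)
  also have "\<dots> = w * (z - j * z)" by (simp add: algebra_simps)
  finally show ?thesis using assms(2) by simp
qed

lemma one_minus_power_factor:
  fixes x :: "'a::ring_1"
  shows "\<exists>q. 1 - x ^ n = q * (1 - x)"
proof (induction n)
  case 0
  show ?case by (auto intro: exI[of _ 0])
next
  case (Suc n)
  then obtain q where "1 - x ^ n = q * (1 - x)" ..
  then have "1 - x ^ Suc n = (x * q + 1) * (1 - x)"
    by (simp add: algebra_simps)
      (metis (no_types, opaque_lifting) add_diff_cancel_left' diff_add_cancel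
        distrib_left mult.assoc mult.right_neutral right_diff_distrib)
  then show ?case by blast
qed

text \<open>\<open>1 - r * x\<close> is a right factor of \<open>1 - (r * x) ^ n\<close>, so it
  inherits left invertibility.\<close>

lemma jacobson_memI_nilpotent:
  fixes x :: "'a::ring_1"
  assumes "\<And>r. \<exists>n. (r * x) ^ n \<in> jacobson"
  shows "x \<in> jacobson"
  unfolding jacobson_iff_left_invertible
proof
  fix r
  obtain n where "(r * x) ^ n \<in> jacobson" using assms by blast
  then obtain w where w: "w * (1 - (r * x) ^ n) = 1" by (rule jacobson_one_minus_unit)
  obtain q where "1 - (r * x) ^ n = q * (1 - r * x)" using one_minus_power_factor by blast
  then have "w * q * (1 - r * x) = 1" using w by (simp add: mult.assoc)
  then show "\<exists>s. s * (1 - r * x) = 1" by blast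
qed

lemma jacobson_idem_mod:
  fixes p y :: "'a::ring_1"
  assumes "a - a * y * a \<in> jacobson"
  shows "(y * a) * (y * a) - y * a \<in> jacobson"
proof -
  have "(y * a) * (y * a) - y * a = - (y * (a - a * y * a))" by (simp add: algebra_simps)
  then show ?thesis
    using assms by (simp add: jacobson_mult_left left_ideal_uminus left_ideal_jacobson)
qed

section \<open>Idempotents and units in semi-\<pi>-regular rings\<close>

lemma semi_pi_regularD:
  fixes x :: "'a::ring_1"
  assumes "semi_pi_regular TYPE('a)"
  obtains n y where "n \<ge> 1" and "x ^ n - x ^ n * y * x ^ n \<in> jacobson"
  using assms unfolding semi_pi_regular_def by blast

lemma semi_pi_regular_lift:
  fixes p :: "'a::ring_1"
  assumes "semi_pi_regular TYPE('a)" and "p * p - p \<in> jacobson"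
  obtains e where "e * e = e" and "e - p \<in> jacobson"
  using assms by (auto simp: semi_pi_regular_def)

text \<open>\<open>e\<close> lifts \<open>y a\<^sup>n\<close>, where \<open>a\<^sup>n y a\<^sup>n = a\<^sup>n\<close> modulo \<open>J\<close>, so that \<open>a\<^sup>n (1 - e)\<close> lies in \<open>J\<close>.\<close>
lemma corner_idempotent:
  fixes f a :: "'a::ring_1"
  assumes semi: "semi_pi_regular TYPE('a)"
    and f: "f * f = f" and fa: "f * a = a" and af: "a * f = a"
  obtains e s where "e * e = e" and "f * e = e" and "e = s * a"
    and "\<And>z. a * z = z \<Longrightarrow> e * z = 0 \<Longrightarrow> z = 0"
proof -
  note J = left_ideal_jacobson
  obtain n y where n: "n \<ge> 1" and ny: "a ^ n - a ^ n * y * a ^ n \<in> jacobson"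
    using semi by (rule semi_pi_regularD)
  obtain m where m: "n = Suc m" using n by (cases n) auto
  define b where "b = a ^ n"
  have bf: "b * f = b" by (simp add: b_def m power_Suc2 mult.assoc af del: power_Suc)
  \<comment> \<open>The factor \<open>f\<close>, together with \<open>b * f = b\<close>, places this
    idempotent modulo \<open>J\<close> in the corner \<open>f R f\<close>.\<close>
  define p where "p = f * y * b"
  have bp: "b - b * p \<in> jacobson"
    using ny by (simp add: p_def b_def[symmetric] mult.assoc[symmetric] bf)
  then have "p * p - p \<in> jacobson"
    using jacobson_idem_mod[of b "f * y"] by (simp add: p_def mult.assoc)
  then obtain e0 where e0: "e0 * e0 = e0" and e0p: "e0 - p \<in> jacobson"
    using semi_pi_regular_lift[OF semi] by blast
  obtain w where wv: "w * (1 - (e0 - p)) = 1" and vw: "(1 - (e0 - p)) * w = 1"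
    and w1: "w - 1 \<in> jacobson"
    using e0p by (rule jacobson_one_minus_unit)
  have e0v: "e0 * (1 - (e0 - p)) = e0 * p" by (simp add: algebra_simps e0)
  \<comment> \<open>A lift \<open>e0\<close> of \<open>p\<close> need not lie in \<open>R b\<close>.
    Since \<open>e0 * (1 - (e0 - p)) = e0 * p\<close>, conjugating \<open>e0\<close> by the unit
    \<open>1 - (e0 - p)\<close> gives an idempotent that ends in \<open>p\<close> and so does lie
    there.\<close>
  define e1 where "e1 = w * e0 * p"
  have e1': "e1 = w * e0 * (1 - (e0 - p))" by (simp add: e1_def mult.assoc e0v)
  have "e1 * e1 = w * e0 * ((1 - (e0 - p)) * w) * e0 * (1 - (e0 - p))"
    unfolding e1' by (simp only: mult.assoc)
  also have "\<dots> = e1" unfolding vw by (simp add: e1' mult.assoc[symmetric])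
      (simp add: mult.assoc e0)
  finally have e1e1: "e1 * e1 = e1" .
  have e1f: "e1 * f = e1" by (simp add: e1_def p_def mult.assoc bf)
  have "e1 - p = (w - 1) * (e0 * p) - e0 * (e0 - p) + (e0 - p)"
    by (simp add: e1_def algebra_simps e0)
  then have e1p: "e1 - p \<in> jacobson"
    using w1 e0p
    by (metis J left_ideal_add left_ideal_diff jacobson_mult_left jacobson_mult_right)
  \<comment> \<open>Because \<open>e1 * f = e1\<close>, the left factor \<open>f\<close> preserves
    idempotency.\<close>
  define e where "e = f * e1"
  have ee: "e * e = e" unfolding e_def by (metis e1e1 e1f mult.assoc)
  have fe: "f * e = e" unfolding e_def by (metis f mult.assoc)
  have es: "e = (f * w * e0 * f * y * a ^ m) * a"
    by (simp add: e_def e1_def p_def b_def m power_Suc2 mult.assoc del: power_Suc)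
  have "e - p = f * (e1 - p)"
    by (simp add: e_def p_def algebra_simps) (simp add: mult.assoc[symmetric] f)
  then have ep: "e - p \<in> jacobson" using e1p by (simp add: jacobson_mult_left)
  have "b - b * e = (b - b * p) - b * (e - p)" by (simp add: algebra_simps)
  then have be: "b - b * e \<in> jacobson"
    using bp ep by (metis J left_ideal_diff jacobson_mult_left)
  have "z = 0" if az: "a * z = z" and ez: "e * z = 0" for z
  proof (rule jacobson_fixed_eq_zero[OF be])
    have "a ^ k * z = z" for k by (induction k) (auto simp: mult.assoc az)
    then show "(b - b * e) * z = z" by (simp add: b_def left_diff_distrib mult.assoc ez)
  qed
  then show ?thesis using that ee fe es by blast
qed

text \<open>Since \<open>ker u\<^sup>2 = ker u\<close> modulo \<open>J\<close>, the kernel of \<open>u\<close> modulo \<open>J\<close> is generated by an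
  idempotent \<open>g\<close> even though only a power of \<open>u\<close> is regular, and \<open>u + g\<close> has zero kernel.\<close>
lemma unit_completion:
  fixes u :: "'a::ring_1"
  assumes semi: "semi_pi_regular TYPE('a)" and df: "dedekind_finite TYPE('a)"
    and ker: "\<And>z. u * (u * z) \<in> jacobson \<Longrightarrow> u * z \<in> jacobson"
  obtains g w where "g * g = g" and "u * g \<in> jacobson"
    and "w * (u + g) = 1" and "(u + g) * w = 1"
proof -
  note J = left_ideal_jacobson
  have kern: "u * z \<in> jacobson" if "u ^ n * z \<in> jacobson" "n \<ge> 1" for n z
    using that(2,1)
  proof (induction n arbitrary: z rule: dec_induct)
    case base
    then show ?case by simp
  next
    case (step n)
    have "u ^ n * (u * z) \<in> jacobson"
      using step.prems by (simp add: power_Suc2 mult.assoc del: power_Suc)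
    then show ?case using step.IH ker by blast
  qed
  obtain n y where n: "n \<ge> 1" and ny: "u ^ n - u ^ n * y * u ^ n \<in> jacobson"
    using semi by (rule semi_pi_regularD)
  obtain m where m: "n = Suc m" using n by (cases n) auto
  \<comment> \<open>Modulo \<open>J\<close> this is an idempotent generating the kernel of
    \<open>u ^ n\<close>, which equals the kernel of \<open>u\<close> by
    \<open>kern\<close>.\<close>
  define p where "p = 1 - y * u ^ n"
  have "p * p - p = (y * u ^ n) * (y * u ^ n) - y * u ^ n" by (simp add: p_def algebra_simps)
  then have "p * p - p \<in> jacobson" using jacobson_idem_mod[OF ny] by simp
  then obtain g where g: "g * g = g" and gp: "g - p \<in> jacobson"
    using semi_pi_regular_lift[OF semi] by blast
  have "u ^ n * p = u ^ n - u ^ n * y * u ^ n" by (simp add: p_def algebra_simps)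
  then have "u * p \<in> jacobson" using kern[of n p] n ny by simp
  moreover have "u * g = u * (g - p) + u * p" by (simp add: algebra_simps)
  ultimately have ug: "u * g \<in> jacobson"
    using gp by (auto intro!: left_ideal_add[OF J] jacobson_mult_left)
  have inj: "z \<in> jacobson" if vz: "(u + g) * z \<in> jacobson" for z
  proof -
    have "u * (u * z) = u * ((u + g) * z) - (u * g) * z" by (simp add: algebra_simps)
    then have "u * (u * z) \<in> jacobson"
      using vz ug by (metis J left_ideal_diff jacobson_mult_left jacobson_mult_right)
    then have uz: "u * z \<in> jacobson" by (rule ker)
    \<comment> \<open>This is \<open>z = p * z + y * u ^ n * z\<close>, with \<open>p * z\<close>
      rewritten through \<open>g * z\<close>.\<close>
    have "z = (u + g) * z - u * z - (g - p) * z + y * u ^ m * (u * z)"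
      by (simp add: p_def m power_Suc2 algebra_simps del: power_Suc)
    then show ?thesis
      using vz uz gp
      by (metis J left_ideal_add left_ideal_diff jacobson_mult_left jacobson_mult_right)
  qed
  \<comment> \<open>Regularity of a power turns injectivity modulo \<open>J\<close> into left
    invertibility: cancelling \<open>(u + g) ^ k\<close> puts \<open>1 - y' * (u + g) ^ k\<close> in
    \<open>J\<close>, so \<open>y' * (u + g) ^ k\<close> is a unit.\<close>
  obtain k y' where k: "k \<ge> 1" and ky: "(u + g) ^ k - (u + g) ^ k * y' * (u + g) ^ k \<in> jacobson"
    using semi by (rule semi_pi_regularD)
  have pow: "z \<in> jacobson" if "(u + g) ^ i * z \<in> jacobson" for i z
    using that by (induction i) (auto simp: mult.assoc dest: inj)
  have "(u + g) ^ k * (1 - y' * (u + g) ^ k) = (u + g) ^ k - (u + g) ^ k * y' * (u + g) ^ k"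
    by (simp add: algebra_simps)
  then have "(u + g) ^ k * (1 - y' * (u + g) ^ k) \<in> jacobson" using ky by (simp only:)
  then have "1 - y' * (u + g) ^ k \<in> jacobson" by (rule pow)
  then obtain s where "s * (1 - (1 - y' * (u + g) ^ k)) = 1"
    by (rule jacobson_one_minus_unit)
  moreover obtain l where "k = Suc l" using k by (cases k) auto
  ultimately have "(s * y' * (u + g) ^ l) * (u + g) = 1"
    by (simp add: power_Suc2 mult.assoc del: power_Suc)
  then show ?thesis using that[OF g ug] df by (auto simp: dedekind_finite_def)
qed

text \<open>Left multiplication by \<open>t\<close> embeds the summand \<open>f R\<close> with image
  \<open>t f R\<close>. By (C2) the image is again a summand, so the inverse map extends to all of
  \<open>R\<close> and is left multiplication by some \<open>c\<close>.\<close>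

lemma C2_left_inverse:
  fixes f t :: "'a::ring_1"
  assumes C2: "C2_RR TYPE('a)" and f: "f * f = f"
    and inj: "\<And>z. f * z = z \<Longrightarrow> t * z = 0 \<Longrightarrow> z = 0"
  obtains c where "f * c = c" and "c * t * f = f"
proof -
  let ?S = "range (\<lambda>r. f * r)" and ?N = "range (\<lambda>r. t * (f * r))"
  have range_right_ideal: "right_ideal (range (\<lambda>r. q * r))" for q :: 'a
    unfolding right_ideal_def
  proof (intro conjI ballI allI impI)
    show "0 \<in> range ((*) q)" by (rule range_eqI[of _ _ 0]) simp
  next
    fix x y assume "x \<in> range ((*) q)" "y \<in> range ((*) q)"
    then obtain r s where "x = q * r" "y = q * s" by auto
    then show "x + y \<in> range ((*) q)" by (intro range_eqI[of _ _ "r + s"]) (simp add: distrib_left)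
  next
    fix x assume "x \<in> range ((*) q)"
    then obtain r where "x = q * r" by auto
    then show "- x \<in> range ((*) q)" by (intro range_eqI[of _ _ "- r"]) simp
  next
    fix s x assume "x \<in> range ((*) q)"
    then obtain r where "x = q * r" by auto
    then show "x * s \<in> range ((*) q)" by (intro range_eqI[of _ _ "r * s"]) (simp add: mult.assoc)
  qed
  have S: "right_ideal ?S" by (rule range_right_ideal)
  have N: "right_ideal ?N" using range_right_ideal[of "t * f"] by (simp add: mult.assoc)
  have fS: "z \<in> ?S \<longleftrightarrow> f * z = z" for z
  proof
    assume "z \<in> ?S"
    then obtain r where "z = f * r" by auto
    then show "f * z = z" by (simp add: mult.assoc[symmetric] f)
  next
    assume "f * z = z"
    then show "z \<in> ?S" by (metis rangeI)
  qed
  have summand: "direct_summand_RR ?S"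
    unfolding direct_summand_RR_def
  proof (intro conjI exI[of _ "range (\<lambda>r. (1 - f) * r)"])
    show "?S \<inter> range (\<lambda>r. (1 - f) * r) = {0}"
    proof (intro equalityI subsetI)
      fix z assume z: "z \<in> ?S \<inter> range (\<lambda>r. (1 - f) * r)"
      then obtain r where r: "z = (1 - f) * r" by blast
      have "z = f * z" using z fS by simp
      also have "\<dots> = 0" by (simp add: r algebra_simps) (simp add: mult.assoc[symmetric] f)
      finally show "z \<in> {0}" by simp
    next
      fix z :: 'a assume "z \<in> {0}"
      then show "z \<in> ?S \<inter> range (\<lambda>r. (1 - f) * r)"
        by (auto intro: range_eqI[of _ _ 0])
    qed
    have "z = f * z + (1 - f) * z" for z by (simp add: algebra_simps)
    then show "\<forall>z. \<exists>s\<in>?S. \<exists>k\<in>range (\<lambda>r. (1 - f) * r). z = s + k" by blast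
  qed (rule S range_right_ideal)+
  \<comment> \<open>(C2) asks for an isomorphism from the candidate onto a known summand, hence the
    inverse of multiplication by \<open>t\<close>.\<close>
  define h where "h = inv_into ?S (\<lambda>z. t * z)"
  have inj_t: "inj_on (\<lambda>z. t * z) ?S"
  proof (rule inj_onI)
    fix y z assume "y \<in> ?S" "z \<in> ?S" "t * y = t * z"
    then have "f * (y - z) = y - z" "t * (y - z) = 0"
      using fS by (auto simp: right_diff_distrib)
    then have "y - z = 0" by (rule inj)
    then show "y = z" by simp
  qed
  have img: "(\<lambda>z. t * z) ` ?S = ?N" by auto
  have h_t: "h (t * z) = z" if "z \<in> ?S" for z
    unfolding h_def using that inj_t by simp
  have "right_module_iso h ?N ?S"
    unfolding right_module_iso_def
  proof (intro conjI ballI allI)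
    show "bij_betw h ?N ?S"
      unfolding h_def by (rule bij_betw_inv_into) (use inj_t img in \<open>simp add: bij_betw_def\<close>)
  next
    fix x y assume "x \<in> ?N" "y \<in> ?N"
    then obtain r s where x: "x = t * (f * r)" and y: "y = t * (f * s)" by auto
    have "x + y = t * (f * (r + s))" by (simp add: x y distrib_left)
    then show "h (x + y) = h x + h y" using h_t by (simp add: x y) (simp add: distrib_left)
  next
    fix x r assume "x \<in> ?N"
    then obtain s where x: "x = t * (f * s)" by auto
    have "x * r = t * (f * (s * r))" by (simp add: x mult.assoc)
    then show "h (x * r) = h x * r" using h_t by (simp add: x mult.assoc)
  qed
  then have "direct_summand_RR ?N" using C2 N summand unfolding C2_RR_def by blast
  then obtain K where K: "right_ideal K" "?N \<inter> K = {0}" "\<And>z. \<exists>s\<in>?N. \<exists>k\<in>K. z = s + k"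
    unfolding direct_summand_RR_def by blast
  \<comment> \<open>The components of \<open>1\<close> are the projections: \<open>k\<close>
    annihilates \<open>t f R\<close>, because \<open>k * (t * f)\<close> lies in both summands, and
    \<open>s\<close> acts on it as the identity. Writing \<open>s = t * f * q\<close> then gives
    \<open>c = f * q\<close>.\<close>
  obtain s k where s: "s \<in> ?N" and k: "k \<in> K" and sk: "1 = s + k" using K(3) by blast
  obtain q where q: "s = t * (f * q)" using s by auto
  have ktf: "k * (t * f) = t * f + - (s * (t * f))"
    using arg_cong[OF sk, of "\<lambda>x. x * (t * f)"] by (simp add: algebra_simps)
  have "s * (t * f) \<in> ?N" by (rule range_eqI[of _ _ "q * t * f"]) (simp add: q mult.assoc)
  moreover have "t * f \<in> ?N" by (rule range_eqI[of _ _ 1]) simp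
  ultimately have "k * (t * f) \<in> ?N"
    unfolding ktf using N unfolding right_ideal_def by blast
  moreover have "k * (t * f) \<in> K" using K(1) k unfolding right_ideal_def by blast
  ultimately have "k * (t * f) \<in> ?N \<inter> K" by blast
  then have "k * (t * f) = 0" using K(2) by blast
  then have "s * (t * f) = t * f" using ktf by simp
  then have "t * (f * q * t * f - f) = 0" by (simp add: q algebra_simps)
  moreover have "f * (f * q * t * f - f) = f * q * t * f - f"
    by (simp add: right_diff_distrib mult.assoc[symmetric] f)
  ultimately have "f * q * t * f - f = 0" using inj by blast
  then have "f * q * t * f = f" by simp
  moreover have "f * (f * q) = f * q" by (simp add: mult.assoc[symmetric] f)
  ultimately show ?thesis using that by blast
qed

section \<open>Linear topologies and summable families\<close>

locale linear_topology =
  fixes \<U> :: "'a::ring_1 set set"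
  assumes basis: "linear_hausdorff_basis \<U>"
begin

text \<open>Sums run over the whole index type; a family on a subset is extended by zero.\<close>

abbreviation sums :: "('i \<Rightarrow> 'a) \<Rightarrow> 'a \<Rightarrow> bool" where
  "sums x r \<equiv> sums_to \<U> UNIV x r"

lemma basis_left_ideal: "U \<in> \<U> \<Longrightarrow> left_ideal U"
  using basis by (simp add: linear_hausdorff_basis_def)

lemma basis_mult_right:
  assumes "U \<in> \<U>"
  obtains V where "V \<in> \<U>" and "\<And>v. v \<in> V \<Longrightarrow> v * r \<in> U"
proof -
  have "\<forall>U\<in>\<U>. \<forall>r. \<exists>V\<in>\<U>. \<forall>v\<in>V. v * r \<in> U"
    using basis by (simp add: linear_hausdorff_basis_def)
  from this[rule_format, OF assms, of r] obtain V
    where V: "V \<in> \<U>" "\<forall>v\<in>V. v * r \<in> U" ..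
  show ?thesis using bspec[OF V(2)] by (rule that[OF V(1)])
qed

lemma eq_zeroI: "(\<And>U. U \<in> \<U> \<Longrightarrow> x \<in> U) \<Longrightarrow> x = 0"
  using basis by (auto simp: linear_hausdorff_basis_def)

lemma sumsI:
  assumes "\<And>U. U \<in> \<U> \<Longrightarrow>
    \<exists>F'. finite F' \<and> (\<forall>F. finite F \<and> F' \<subseteq> F \<longrightarrow> sum x F - r \<in> U)"
  shows "sums x r"
  using assms by (simp add: sums_to_def)

lemma sumsE:
  assumes "sums x r" and "U \<in> \<U>"
  obtains F' where "finite F'" and "\<And>F. finite F \<Longrightarrow> F' \<subseteq> F \<Longrightarrow> sum x F - r \<in> U"
proof -
  have "\<exists>F'. finite F' \<and> (\<forall>F. finite F \<and> F' \<subseteq> F \<longrightarrow> sum x F - r \<in> U)"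
    using assms by (simp add: sums_to_def)
  then show ?thesis using that by blast
qed

lemma sums_add:
  assumes "sums x r" and "sums y s"
  shows "sums (\<lambda>i. x i + y i) (r + s)"
proof (rule sumsI)
  fix U assume U: "U \<in> \<U>"
  obtain F1 where F1: "finite F1" "\<And>F. finite F \<Longrightarrow> F1 \<subseteq> F \<Longrightarrow> sum x F - r \<in> U"
    using assms(1) U by (rule sumsE) blast
  obtain F2 where F2: "finite F2" "\<And>F. finite F \<Longrightarrow> F2 \<subseteq> F \<Longrightarrow> sum y F - s \<in> U"
    using assms(2) U by (rule sumsE) blast
  have "(\<Sum>i\<in>F. x i + y i) - (r + s) \<in> U" if "finite F" "F1 \<union> F2 \<subseteq> F" for F
  proof -
    have "(\<Sum>i\<in>F. x i + y i) - (r + s) = (sum x F - r) + (sum y F - s)"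
      by (simp add: sum.distrib)
    moreover have "(sum x F - r) + (sum y F - s) \<in> U"
      using that F1(2) F2(2) by (intro left_ideal_add[OF basis_left_ideal[OF U]]) auto
    ultimately show ?thesis by (simp only:)
  qed
  then show "\<exists>F'. finite F' \<and> (\<forall>F. finite F \<and> F' \<subseteq> F \<longrightarrow> (\<Sum>i\<in>F. x i + y i) - (r + s) \<in> U)"
    using F1(1) F2(1) by (intro exI[of _ "F1 \<union> F2"]) auto
qed

lemma sums_mult_left:
  assumes "sums x r"
  shows "sums (\<lambda>i. c * x i) (c * r)"
proof (rule sumsI)
  fix U assume U: "U \<in> \<U>"
  obtain F1 where F1: "finite F1" "\<And>F. finite F \<Longrightarrow> F1 \<subseteq> F \<Longrightarrow> sum x F - r \<in> U"
    using assms(1) U by (rule sumsE) blast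
  have "(\<Sum>i\<in>F. c * x i) - c * r = c * (sum x F - r)" for F
    by (simp add: sum_distrib_left right_diff_distrib)
  then show "\<exists>F'. finite F' \<and> (\<forall>F. finite F \<and> F' \<subseteq> F \<longrightarrow> (\<Sum>i\<in>F. c * x i) - c * r \<in> U)"
    using F1 left_ideal_mult[OF basis_left_ideal[OF U]] by (intro exI[of _ F1]) simp
qed

lemma sums_mult_right:
  assumes "sums x r"
  shows "sums (\<lambda>i. x i * c) (r * c)"
proof (rule sumsI)
  fix U assume U: "U \<in> \<U>"
  obtain V where V: "V \<in> \<U>" "\<And>v. v \<in> V \<Longrightarrow> v * c \<in> U" using U by (rule basis_mult_right) blast
  obtain F1 where F1: "finite F1" "\<And>F. finite F \<Longrightarrow> F1 \<subseteq> F \<Longrightarrow> sum x F - r \<in> V"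
    using assms(1) V(1) by (rule sumsE) blast
  have "(\<Sum>i\<in>F. x i * c) - r * c = (sum x F - r) * c" for F
    by (simp add: sum_distrib_right left_diff_distrib)
  then show "\<exists>F'. finite F' \<and> (\<forall>F. finite F \<and> F' \<subseteq> F \<longrightarrow> (\<Sum>i\<in>F. x i * c) - r * c \<in> U)"
    using F1 V(2) by (intro exI[of _ F1]) simp
qed

lemma sums_diff:
  assumes "sums x r" and "sums y s"
  shows "sums (\<lambda>i. x i - y i) (r - s)"
  using sums_add[OF assms(1) sums_mult_left[OF assms(2), of "- 1"]] by simp

lemma sums_single: "sums (\<lambda>i. if i = k then a else 0) a"
proof (rule sumsI)
  fix U assume U: "U \<in> \<U>"
  have "(\<Sum>i\<in>F. if i = k then a else 0) - a \<in> U" if "finite F" "{k} \<subseteq> F" for F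
    using that left_ideal_zero[OF basis_left_ideal[OF U]] by simp
  then show "\<exists>F'. finite F' \<and> (\<forall>F. finite F \<and> F' \<subseteq> F \<longrightarrow> (\<Sum>i\<in>F. if i = k then a else 0) - a \<in> U)"
    by (intro exI[of _ "{k}"]) blast
qed

lemma sums_zero: "sums (\<lambda>i :: 'i. 0) 0"
  using sums_single[of "undefined :: 'i" 0] by simp

section \<open>Closed left ideals and uniqueness of sums\<close>

definition closed_left_ideal :: "'a set \<Rightarrow> bool" where
  "closed_left_ideal L \<longleftrightarrow> left_ideal L \<and> (\<forall>x. (\<forall>U\<in>\<U>. \<exists>l\<in>L. x - l \<in> U) \<longrightarrow> x \<in> L)"

lemma closed_left_ideal_zero: "closed_left_ideal {0}"
  unfolding closed_left_ideal_def
proof (intro conjI allI impI)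
  show "left_ideal {0}" by (simp add: left_ideal_def)
next
  fix x assume "\<forall>U\<in>\<U>. \<exists>l\<in>{0}. x - l \<in> U"
  then show "x \<in> {0}" using eq_zeroI[of x] by simp
qed

lemma sums_mem_closed:
  assumes L: "closed_left_ideal L" and "sums x r" and "\<And>i. x i \<in> L"
  shows "r \<in> L"
proof -
  have li: "left_ideal L" using L by (simp add: closed_left_ideal_def)
  have "\<exists>l\<in>L. r - l \<in> U" if U: "U \<in> \<U>" for U
  proof -
    obtain F1 where "finite F1" "\<And>F. finite F \<Longrightarrow> F1 \<subseteq> F \<Longrightarrow> sum x F - r \<in> U"
      using assms(2) U by (rule sumsE) blast
    then have "r - sum x F1 \<in> U"
      using left_ideal_diff_swap[OF basis_left_ideal[OF U]] by blast
    moreover have "sum x F1 \<in> L" using li assms(3) by (intro left_ideal_sum)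
    ultimately show ?thesis by blast
  qed
  then show ?thesis using L by (simp add: closed_left_ideal_def)
qed

lemma sums_unique:
  assumes "sums x r" and "sums x s"
  shows "r = s"
  using sums_mem_closed[OF closed_left_ideal_zero sums_diff[OF assms]] by simp

definition ideal_closure :: "'a set \<Rightarrow> 'a set" where
  "ideal_closure K = {x. \<forall>U\<in>\<U>. \<exists>l\<in>K. x - l \<in> U}"

lemma ideal_closure_iff: "x \<in> ideal_closure K \<longleftrightarrow> (\<forall>U\<in>\<U>. \<exists>l\<in>K. x - l \<in> U)"
  by (simp add: ideal_closure_def)

lemma ideal_closure_superset: "K \<subseteq> ideal_closure K"
proof
  fix x assume "x \<in> K"
  then show "x \<in> ideal_closure K"
    using left_ideal_zero[OF basis_left_ideal]
    unfolding ideal_closure_iff by (auto intro!: bexI[of _ x])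
qed

lemma closed_left_ideal_closure:
  assumes K: "left_ideal K"
  shows "closed_left_ideal (ideal_closure K)"
proof -
  have add: "x + y \<in> ideal_closure K" if xy: "x \<in> ideal_closure K" "y \<in> ideal_closure K" for x y
    unfolding ideal_closure_iff
  proof
    fix U assume U: "U \<in> \<U>"
    obtain j k where jk: "j \<in> K" "x - j \<in> U" "k \<in> K" "y - k \<in> U"
      using xy U unfolding ideal_closure_iff by blast
    have "(x - j) + (y - k) \<in> U" using jk left_ideal_add[OF basis_left_ideal[OF U]] by blast
    then have "(x + y) - (j + k) \<in> U" by (simp add: algebra_simps)
    then show "\<exists>l\<in>K. x + y - l \<in> U" using jk left_ideal_add[OF K] by blast
  qed
  have mult: "r * x \<in> ideal_closure K" if x: "x \<in> ideal_closure K" for r x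
    unfolding ideal_closure_iff
  proof
    fix U assume U: "U \<in> \<U>"
    obtain j where j: "j \<in> K" "x - j \<in> U" using x U unfolding ideal_closure_iff by blast
    have "r * (x - j) \<in> U" using j(2) left_ideal_mult[OF basis_left_ideal[OF U]] by blast
    then have "r * x - r * j \<in> U" by (simp add: right_diff_distrib)
    then show "\<exists>l\<in>K. r * x - l \<in> U" using j(1) left_ideal_mult[OF K] by blast
  qed
  have "- x \<in> ideal_closure K" if "x \<in> ideal_closure K" for x
    using mult[OF that, of "- 1"] by simp
  moreover have "0 \<in> ideal_closure K" using left_ideal_zero[OF K] ideal_closure_superset by blast
  ultimately have "left_ideal (ideal_closure K)" using add mult unfolding left_ideal_def by blast
  moreover have "x \<in> ideal_closure K" if x: "\<forall>U\<in>\<U>. \<exists>l\<in>ideal_closure K. x - l \<in> U" for x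
    unfolding ideal_closure_iff
  proof
    fix U assume U: "U \<in> \<U>"
    obtain l where l: "l \<in> ideal_closure K" "x - l \<in> U" using x U by blast
    then obtain j where j: "j \<in> K" "l - j \<in> U" using U unfolding ideal_closure_iff by blast
    have "(x - l) + (l - j) \<in> U" using l(2) j(2) left_ideal_add[OF basis_left_ideal[OF U]] by blast
    then have "x - j \<in> U" by simp
    then show "\<exists>j\<in>K. x - j \<in> U" using j(1) by blast
  qed
  ultimately show ?thesis unfolding closed_left_ideal_def by blast
qed

text \<open>For \<open>j\<close> in \<open>J\<close> close to \<open>e\<close>, the element \<open>e - e j e\<close> is both a unit of \<open>e R e\<close> and small.\<close>
lemma closure_jacobson_idempotent:
  assumes e: "e * e = e" and cl: "e \<in> ideal_closure jacobson"
  shows "e = 0"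
proof (rule eq_zeroI)
  fix U assume U: "U \<in> \<U>"
  obtain V where V: "V \<in> \<U>" "\<And>v. v \<in> V \<Longrightarrow> v * e \<in> U" using U by (rule basis_mult_right) blast
  obtain j where j: "j \<in> jacobson" "e - j \<in> V" using cl V(1) unfolding ideal_closure_iff by blast
  have "e * (e - j) * e \<in> U"
    using V(2) j(2) left_ideal_mult[OF basis_left_ideal[OF V(1)]] by blast
  moreover have "e * (e - j) * e = (1 - e * j * e) * e"
    by (simp add: left_diff_distrib right_diff_distrib mult.assoc e)
  moreover have "e * j * e \<in> jacobson" using j(1) jacobson_mult_left jacobson_mult_right by blast
  then obtain q where q: "q * (1 - e * j * e) = 1" by (rule jacobson_one_minus_unit)
  ultimately have "q * ((1 - e * j * e) * e) \<in> U"
    using left_ideal_mult[OF basis_left_ideal[OF U]] by simp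
  moreover have "q * ((1 - e * j * e) * e) = e" using q by (simp add: mult.assoc[symmetric])
  ultimately show "e \<in> U" by simp
qed

text \<open>For \<open>x\<close> in the closure \<open>C\<close>, the idempotent lifting
  \<open>y * x ^ n\<close> also lies in \<open>C\<close> and is therefore \<open>0\<close>; this
  forces \<open>x ^ n\<close> into \<open>J\<close>. A left ideal all of whose elements have a power
  in \<open>J\<close> is contained in \<open>J\<close>.\<close>

lemma closed_left_ideal_jacobson:
  assumes semi: "semi_pi_regular TYPE('a)"
  shows "closed_left_ideal (jacobson :: 'a set)"
proof -
  define C where "C = ideal_closure (jacobson :: 'a set)"
  have closed_C: "closed_left_ideal C"
    unfolding C_def by (rule closed_left_ideal_closure[OF left_ideal_jacobson])
  then have C: "left_ideal C" by (simp add: closed_left_ideal_def)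
  have JC: "jacobson \<subseteq> C" unfolding C_def by (rule ideal_closure_superset)
  have nil: "\<exists>n. x ^ n \<in> jacobson" if x: "x \<in> C" for x
  proof -
    obtain n y where n: "n \<ge> 1" and ny: "x ^ n - x ^ n * y * x ^ n \<in> jacobson"
      using semi by (rule semi_pi_regularD)
    obtain m where m: "n = Suc m" using n by (cases n) auto
    define p where "p = y * x ^ n"
    have p: "p * p - p \<in> jacobson" unfolding p_def using ny by (rule jacobson_idem_mod)
    then obtain e where e: "e * e = e" and ep: "e - p \<in> jacobson"
      using semi_pi_regular_lift[OF semi] by blast
    have "p = (y * x ^ m) * x" by (simp add: p_def m power_Suc2 mult.assoc del: power_Suc)
    then have "p \<in> C" using left_ideal_mult[OF C x] by blast
    then have "p + (e - p) \<in> C" using ep JC left_ideal_add[OF C] by blast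
    then have "e \<in> C" by simp
    then have "e = 0" using e closure_jacobson_idempotent unfolding C_def by blast
    then have "p \<in> jacobson" using ep left_ideal_uminus[OF left_ideal_jacobson, of "e - p"] by simp
    then have "x ^ n * p \<in> jacobson" by (rule jacobson_mult_left)
    then have "(x ^ n - x ^ n * y * x ^ n) + x ^ n * p \<in> jacobson"
      by (rule left_ideal_add[OF left_ideal_jacobson ny])
    moreover have "(x ^ n - x ^ n * y * x ^ n) + x ^ n * p = x ^ n"
      by (simp add: p_def mult.assoc)
    ultimately have "x ^ n \<in> jacobson" by (simp only:)
    then show ?thesis ..
  qed
  have "C \<subseteq> jacobson"
    by (intro subsetI jacobson_memI_nilpotent nil left_ideal_mult[OF C])
  then have "C = jacobson" using JC by blast
  then show ?thesis using closed_C by simp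
qed

end

section \<open>Triangular families of idempotents\<close>

locale well_ordered_topology = linear_topology \<U> for \<U> :: "'a::ring_1 set set" +
  fixes lt :: "'i \<Rightarrow> 'i \<Rightarrow> bool"
  assumes lt_wf: "wfP lt" and lt_trans: "lt i j \<Longrightarrow> lt j k \<Longrightarrow> lt i k"
    and lt_total: "i \<noteq> j \<Longrightarrow> lt i j \<or> lt j i"
begin

lemma lt_irrefl: "\<not> lt i i"
  using wfp_induct_rule[OF lt_wf, of "\<lambda>i. \<not> lt i i"] by blast

text \<open>This half of orthogonality is what a recursion delivers: a new idempotent can be placed
  in the common kernel of the earlier ones, while its product with them in the other order stays
  uncontrolled.\<close>

definition triangular :: "('i \<Rightarrow> 'a) \<Rightarrow> bool" where
  "triangular e \<longleftrightarrow> (\<forall>i. e i * e i = e i) \<and> (\<forall>i j. lt i j \<longrightarrow> e i * e j = 0)"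

text \<open>Forward substitution: \<open>e i * D j = e i * e j * D j\<close> vanishes for
  \<open>j\<close> above \<open>i\<close>, so \<open>e i * s\<close> is \<open>D i\<close> plus a
  sum of earlier terms, which lies in \<open>L\<close> by induction and closedness. A general
  \<open>L\<close> serves equality, congruence modulo \<open>J\<close> and approximation at
  once.\<close>

lemma triangular_solve:
  assumes tri: "triangular e" and L: "closed_left_ideal L" and D: "sums D s"
    and eD: "\<And>i. e i * D i = D i" and es: "\<And>i. e i * s \<in> L"
  shows "D i \<in> L"
proof (induction i rule: wfp_induct_rule[OF lt_wf])
  case (1 i)
  have li: "left_ideal L" using L by (simp add: closed_left_ideal_def)
  have split: "e i * D j - (if j = i then D i else 0) = (if lt j i then e i * D j else 0)" for j
  proof (cases "j = i \<or> lt j i")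
    case True
    then show ?thesis using lt_irrefl eD by auto
  next
    case False
    then have "e i * e j = 0" using tri lt_total[of i j] by (auto simp: triangular_def)
    then have "e i * D j = 0" by (metis eD mult.assoc mult_zero_left)
    then show ?thesis using False by simp
  qed
  have "sums (\<lambda>j. if lt j i then e i * D j else 0) (e i * s - D i)"
    using sums_diff[OF sums_mult_left[OF D, of "e i"] sums_single[of i "D i"]]
    by (simp only: split)
  then have "e i * s - D i \<in> L"
    by (rule sums_mem_closed[OF L])
      (auto intro: left_ideal_mult[OF li] left_ideal_zero[OF li] 1)
  then have "e i * s - (e i * s - D i) \<in> L" using es left_ideal_diff[OF li] by blast
  then show ?case by simp
qed

text \<open>The system is solved for \<open>D i = e i * z\<close>, whose sum is
  \<open>u * z\<close>.\<close>

lemma triangular_kernel_closed: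
  assumes "triangular e" and "closed_left_ideal L" and "sums e u" and "\<And>i. e i * (u * z) \<in> L"
  shows "e i * z \<in> L"
proof -
  have "e j * (e j * z) = e j * z" for j
    using assms(1) by (simp add: triangular_def mult.assoc[symmetric])
  then show ?thesis
    using triangular_solve[OF assms(1,2) sums_mult_right[OF assms(3), of z]] assms(4) by blast
qed

lemma triangular_kernel:
  assumes "triangular e" and u: "sums e u"
  shows "u * z = 0 \<longleftrightarrow> (\<forall>i. e i * z = 0)"
proof
  assume "u * z = 0"
  then show "\<forall>i. e i * z = 0"
    using triangular_kernel_closed[OF assms(1) closed_left_ideal_zero u, of z] by simp
next
  assume "\<forall>i. e i * z = 0"
  then have "sums (\<lambda>i :: 'i. 0) (u * z)" using sums_mult_right[OF u, of z] by simp
  then show "u * z = 0" using sums_unique sums_zero by blast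
qed

text \<open>With \<open>g\<close> as in \<open>unit_completion\<close>, \<open>v = (u + g)\<^sup>-\<^sup>1\<close> and \<open>m = u v g\<close>, every \<open>e i * m\<close>
  lies in \<open>J m\<close>; solving the triangular system puts \<open>m\<close> itself in the closure of \<open>J m\<close>, so
  \<open>m = 0\<close>. This removes the indeterminacy modulo \<open>J\<close>.\<close>
lemma triangular_complement:
  assumes semi: "semi_pi_regular TYPE('a)" and df: "dedekind_finite TYPE('a)"
    and tri: "triangular e" and u: "sums e u"
  obtains f w where "f * f = f" and "u * f = 0" and "w * u = 1 - f"
proof -
  note J = closed_left_ideal_jacobson[OF semi]
  have "u * z \<in> jacobson" if "u * (u * z) \<in> jacobson" for z
  proof -
    have "e i * (u * (u * z)) \<in> jacobson" for i using that by (rule jacobson_mult_left)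
    then have "e i * (u * z) \<in> jacobson" for i by (rule triangular_kernel_closed[OF tri J u])
    then have "e i * z \<in> jacobson" for i by (rule triangular_kernel_closed[OF tri J u])
    then show ?thesis by (rule sums_mem_closed[OF J sums_mult_right[OF u]])
  qed
  then obtain g v where g: "g * g = g" and ug: "u * g \<in> jacobson"
    and vl: "v * (u + g) = 1" and vr: "(u + g) * v = 1"
    by (rule unit_completion[OF semi df])
  \<comment> \<open>As \<open>v * u = 1 - v * g\<close>, this \<open>f\<close> fixes every element
    of \<open>ker u\<close>; it is a projection onto \<open>ker u\<close> once
    \<open>u * f = 0\<close> is known.\<close>
  define f where "f = v * g"
  define m where "m = u * f"
  have uf: "(u + g) * f = g" by (simp add: f_def mult.assoc[symmetric] vr)
  then have m: "m = g - g * f" by (simp add: m_def algebra_simps)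
  have gm: "g * m = m" by (simp add: m right_diff_distrib mult.assoc[symmetric] g)
  define K where "K = {j * m | j. j \<in> jacobson}"
  have K: "left_ideal K" unfolding K_def using left_ideal_jacobson by (rule left_ideal_mult_right)
  have eg: "e i * g \<in> jacobson" for i
    using triangular_kernel_closed[OF tri J u, of g i] ug jacobson_mult_left by blast
  have em: "e i * (u * f) \<in> ideal_closure K" for i
  proof -
    have "e i * (u * f) = (e i * g) * m" by (simp add: mult.assoc gm m_def[symmetric])
    then have "e i * (u * f) \<in> K" using eg[of i] unfolding K_def by blast
    then show ?thesis using ideal_closure_superset by blast
  qed
  have "e i * f \<in> ideal_closure K" for i
    by (rule triangular_kernel_closed[OF tri closed_left_ideal_closure[OF K] u em])
  then have mC: "m \<in> ideal_closure K"
    using sums_mem_closed[OF closed_left_ideal_closure[OF K] sums_mult_right[OF u]]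
    by (simp add: m_def)
  have "m = 0"
  proof (rule eq_zeroI)
    fix U assume U: "U \<in> \<U>"
    then obtain j where j: "j \<in> jacobson" "m - j * m \<in> U"
      using mC unfolding ideal_closure_iff K_def by blast
    obtain q where q: "q * (1 - j) = 1" using j(1) by (rule jacobson_one_minus_unit)
    have "q * (m - j * m) = q * (1 - j) * m" by (simp add: algebra_simps)
    then show "m \<in> U"
      using left_ideal_mult[OF basis_left_ideal[OF U] j(2), of q] q by simp
  qed
  then have "g * f = g" and "u * f = 0" using m by (auto simp: m_def)
  then have "f * f = f" by (simp add: f_def mult.assoc)
  moreover have "v * u = 1 - f" using vl by (simp add: f_def algebra_simps)
  ultimately show ?thesis using that \<open>u * f = 0\<close> by blast
qed

end
section \<open>Transfinite construction of the exchange idempotents\<close>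

locale summable_partition = well_ordered_topology \<U> lt
  for \<U> :: "'a::ring_1 set set" and lt :: "'i \<Rightarrow> 'i \<Rightarrow> bool" +
  fixes x :: "'i \<Rightarrow> 'a"
  assumes nice: "sums (y :: 'i \<Rightarrow> 'a) s \<Longrightarrow> \<exists>s'. sums (\<lambda>i. r i * y i) s'"
    and sums_x: "sums x 1"
    and semi: "semi_pi_regular TYPE('a)"
    and df: "dedekind_finite TYPE('a)"
    and C2: "C2_RR TYPE('a)"
begin

section \<open>Subsums of the given family\<close>

definition part :: "'i set \<Rightarrow> 'a" where
  "part S = (THE s. sums (\<lambda>i. if i \<in> S then x i else 0) s)"

text \<open>Niceness with coefficients \<open>1\<close> on \<open>S\<close> and \<open>0\<close>
  elsewhere gives existence; uniqueness of sums makes the definite description proper.\<close>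

lemma part_sums: "sums (\<lambda>i. if i \<in> S then x i else 0) (part S)"
proof -
  have "\<exists>s. sums (\<lambda>i. (if i \<in> S then 1 else 0) * x i) s" using sums_x by (rule nice)
  moreover have "(\<lambda>i. (if i \<in> S then 1 else 0) * x i) = (\<lambda>i. if i \<in> S then x i else 0)"
    by auto
  ultimately have "\<exists>s. sums (\<lambda>i. if i \<in> S then x i else 0) s" by simp
  then have "\<exists>!s. sums (\<lambda>i. if i \<in> S then x i else 0) s" using sums_unique by blast
  then show ?thesis unfolding part_def by (rule theI')
qed

lemma part_eqI: "sums (\<lambda>i. if i \<in> S then x i else 0) s \<Longrightarrow> part S = s"
  using part_sums by (rule sums_unique)

lemma part_UNIV: "part UNIV = 1"
  using sums_x by (intro part_eqI) simp

lemma part_empty: "part {} = 0"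
  using sums_zero by (intro part_eqI) simp

lemma part_singleton: "part {i} = x i"
proof (rule part_eqI)
  have "(\<lambda>j. if j \<in> {i} then x j else 0) = (\<lambda>j. if j = i then x i else 0)" by auto
  then show "sums (\<lambda>j. if j \<in> {i} then x j else 0) (x i)" using sums_single[of i "x i"] by simp
qed

lemma part_Un:
  assumes "S \<inter> T = {}"
  shows "part (S \<union> T) = part S + part T"
proof (rule part_eqI)
  have "(\<lambda>i. (if i \<in> S then x i else 0) + (if i \<in> T then x i else 0))
      = (\<lambda>i. if i \<in> S \<union> T then x i else 0)"
    using assms by (intro ext) auto
  then show "sums (\<lambda>i. if i \<in> S \<union> T then x i else 0) (part S + part T)"
    using sums_add[OF part_sums part_sums, of S T] by simp
qed

lemma finite_bounded:
  assumes "finite A" and "j0 \<in> S" and "A \<subseteq> S"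
  shows "\<exists>j\<in>S. \<forall>k\<in>A. \<not> lt j k"
  using assms(1,3)
proof (induction A rule: finite_induct)
  case empty
  then show ?case using assms(2) by blast
next
  case (insert a A)
  then obtain j where j: "j \<in> S" "\<forall>k\<in>A. \<not> lt j k" by blast
  show ?case
  proof (cases "lt j a")
    case True
    then have "\<forall>k\<in>insert a A. \<not> lt a k" using j(2) lt_trans lt_irrefl by blast
    then show ?thesis using insert.prems by blast
  next
    case False
    then show ?thesis using j by blast
  qed
qed

text \<open>A Cauchy argument: if \<open>j\<close> is not below any index of
  \<open>F \<inter> S\<close>, every finite subsum beyond \<open>j\<close> is a difference of two
  partial sums over sets containing \<open>F\<close>.\<close>

lemma part_tail_small:
  assumes U: "U \<in> \<U>" and "j0 \<in> S"
  shows "\<exists>j\<in>S. part {k \<in> S. lt j k} \<in> U"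
proof -
  note li = basis_left_ideal[OF U]
  define y where "y = (\<lambda>i. if i \<in> S then x i else 0)"
  have "sums y (part S)" unfolding y_def by (rule part_sums)
  then obtain F where F: "finite F" "\<And>G. finite G \<Longrightarrow> F \<subseteq> G \<Longrightarrow> sum y G - part S \<in> U"
    using U by (rule sumsE) blast
  obtain j where j: "j \<in> S" "\<forall>k\<in>F \<inter> S. \<not> lt j k"
    using finite_bounded[of "F \<inter> S" j0 S] F(1) assms(2) by auto
  let ?T = "{k \<in> S. lt j k}"
  have fin: "sum (\<lambda>i. if i \<in> ?T then x i else 0) G \<in> U" if G: "finite G" for G
  proof -
    have "sum (\<lambda>i. if i \<in> ?T then x i else 0) G = sum x (G \<inter> ?T)"
      using G by (simp add: sum.inter_restrict)
    also have "\<dots> = sum y (G \<inter> ?T)" by (rule sum.cong) (auto simp: y_def)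
    also have "\<dots> = sum y (F \<union> (G \<inter> ?T)) - sum y F"
      using F(1) G j(2) by (subst sum.union_disjoint) auto
    also have "\<dots> = (sum y (F \<union> (G \<inter> ?T)) - part S) - (sum y F - part S)" by simp
    also have "\<dots> \<in> U" using F(1) G by (intro left_ideal_diff[OF li] F(2)) auto
    finally show ?thesis .
  qed
  obtain H where H: "finite H"
    "\<And>G. finite G \<Longrightarrow> H \<subseteq> G \<Longrightarrow> sum (\<lambda>i. if i \<in> ?T then x i else 0) G - part ?T \<in> U"
    using part_sums U by (rule sumsE) blast
  have "sum (\<lambda>i. if i \<in> ?T then x i else 0) H - part ?T \<in> U" using H by blast
  \<comment> \<open>The limit differs by an element of \<open>U\<close> from a finite sum that is
    itself in \<open>U\<close>.\<close>
  with fin[OF H(1)] have "part ?T \<in> U" using left_ideal_diff[OF li] by fastforce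
  then show ?thesis using j(1) by blast
qed

text \<open>The predicate reads \<open>e\<close> only below \<open>i\<close>, as well-founded
  recursion requires.\<close>

definition admissible :: "('i \<Rightarrow> 'a) \<Rightarrow> 'i \<Rightarrow> 'a \<Rightarrow> bool" where
  "admissible e i r \<longleftrightarrow> r * r = r \<and> (\<exists>q. r = q * x i) \<and> (\<forall>j. lt j i \<longrightarrow> e j * r = 0)"

text \<open>The second conjunct makes left multiplication by the tail \<open>\<Sum>k>i. x k\<close> split injective on
  the common kernel of the idempotents up to \<open>i\<close>; this is what survives at limits.\<close>
definition exchange_step :: "('i \<Rightarrow> 'a) \<Rightarrow> 'i \<Rightarrow> 'a \<Rightarrow> bool" where
  "exchange_step e i r \<longleftrightarrow> admissible e i r \<and>
     (\<exists>c. \<forall>z. (\<forall>j. lt j i \<longrightarrow> e j * z = 0) \<longrightarrow> r * z = 0 \<longrightarrow> c * (part {k. lt i k} * z) = z)"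

text \<open>Extending by zero outside \<open>S\<close> keeps the family triangular, and
  \<open>e i = q i * x i\<close> makes it summable by niceness, so the common kernel is the kernel
  of its sum \<open>u\<close>.\<close>

lemma segment_complement:
  assumes adm: "\<And>i. i \<in> S \<Longrightarrow> admissible e i (e i)"
  obtains p u w where "p * p = p" and "\<forall>z. p * z = z \<longleftrightarrow> (\<forall>i\<in>S. e i * z = 0)"
    and "sums (\<lambda>i. if i \<in> S then e i else 0) u" and "w * u = 1 - p"
proof -
  let ?e = "\<lambda>i. if i \<in> S then e i else 0"
  have "\<forall>i. \<exists>q. ?e i = q * x i"
  proof
    fix i
    show "\<exists>q. ?e i = q * x i"
      using adm[of i] by (cases "i \<in> S") (auto simp: admissible_def intro: exI[of _ 0])
  qed
  then obtain q where q: "\<And>i. ?e i = q i * x i" by metis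
  obtain u where "sums (\<lambda>i. q i * x i) u" using nice[OF sums_x] by blast
  then have u: "sums ?e u" by (simp only: q)
  have tri: "triangular ?e" using adm by (auto simp: triangular_def admissible_def)
  obtain p w where p: "p * p = p" "u * p = 0" and w: "w * u = 1 - p"
    using triangular_complement[OF semi df tri u] by blast
  have "p * z = z \<longleftrightarrow> u * z = 0" for z
  proof
    assume "p * z = z"
    then have "u * z = (u * p) * z" by (simp add: mult.assoc)
    then show "u * z = 0" using p(2) by simp
  next
    assume "u * z = 0"
    then have "(w * u) * z = 0" by (simp add: mult.assoc)
    then show "p * z = z" by (simp add: w left_diff_distrib)
  qed
  then have "p * z = z \<longleftrightarrow> (\<forall>i\<in>S. e i * z = 0)" for z
    unfolding triangular_kernel[OF tri u] by auto
  then show ?thesis using that p(1) u w by blast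
qed

text \<open>(C2) upgrades injectivity of \<open>t\<close> on the common kernel \<open>p R\<close> to
  split injectivity.\<close>

lemma segment_inverse:
  assumes adm: "\<And>i. i \<in> S \<Longrightarrow> admissible e i (e i)"
    and inj: "\<And>z. (\<And>i. i \<in> S \<Longrightarrow> e i * z = 0) \<Longrightarrow> t * z = 0 \<Longrightarrow> z = 0"
  obtains p c where "p * p = p" and "\<forall>z. p * z = z \<longleftrightarrow> (\<forall>i\<in>S. e i * z = 0)"
    and "p * c = c" and "c * t * p = p"
proof -
  obtain p u w where p: "p * p = p" and ker: "\<forall>z. p * z = z \<longleftrightarrow> (\<forall>i\<in>S. e i * z = 0)"
    and "sums (\<lambda>i. if i \<in> S then e i else 0) u" and "w * u = 1 - p"
    by (rule segment_complement[OF adm])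
  have "z = 0" if "p * z = z" "t * z = 0" for z
    using that ker inj by blast
  then obtain c where "p * c = c" "c * t * p = p"
    using C2_left_inverse[OF C2 p] by blast
  then show ?thesis using that p ker by blast
qed

text \<open>For late \<open>j\<close> in \<open>S\<close>, the part of the tail after
  \<open>j\<close> inside \<open>S\<close> is small, and the part outside \<open>S\<close> kills
  \<open>z\<close>. Hence \<open>z = c * v * z\<close> with \<open>v\<close> small, and this lies in
  \<open>U\<close> whatever \<open>c\<close> is, as \<open>U\<close> is a left ideal. Successor and
  limit stages are treated alike.\<close>

lemma segment_injective:
  assumes down: "\<And>i j. i \<in> S \<Longrightarrow> lt j i \<Longrightarrow> j \<in> S"
    and step: "\<And>i. i \<in> S \<Longrightarrow> exchange_step e i (e i)"
    and ez: "\<And>i. i \<in> S \<Longrightarrow> e i * z = 0" and tz: "part (- S) * z = 0"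
  shows "z = 0"
proof (cases "S = {}")
  case True
  then show ?thesis using tz by (simp add: part_UNIV)
next
  case False
  then obtain j0 where j0: "j0 \<in> S" by blast
  show ?thesis
  proof (rule eq_zeroI)
    fix U assume U: "U \<in> \<U>"
    obtain V where V: "V \<in> \<U>" "\<And>v. v \<in> V \<Longrightarrow> v * z \<in> U" using U by (rule basis_mult_right) blast
    obtain j where j: "j \<in> S" "part {k \<in> S. lt j k} \<in> V"
      using part_tail_small[OF V(1) j0] by blast
    obtain c where c: "c * (part {k. lt j k} * z) = z"
      using step[OF j(1)] ez down j(1) unfolding exchange_step_def by blast
    have "lt j k" if "k \<notin> S" for k using that j(1) down lt_total[of j k] by blast
    then have "{k. lt j k} = {k \<in> S. lt j k} \<union> - S" by blast
    then have "part {k. lt j k} = part {k \<in> S. lt j k} + part (- S)"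
      by (simp only:) (rule part_Un, blast)
    then have "c * (part {k \<in> S. lt j k} * z) = z"
      using c tz by (simp add: distrib_right)
    then show "z \<in> U" using left_ideal_mult[OF basis_left_ideal[OF U] V(2)[OF j(2)], of c] by simp
  qed
qed

text \<open>Let \<open>c\<close> invert the tail from \<open>i\<close> on \<open>p R\<close>. An
  element of \<open>p R\<close> killed by the tail after \<open>i\<close> is a fixed point of
  \<open>a = c * x i * p\<close>, so an idempotent that kills no nonzero fixed point of
  \<open>a\<close> leaves the remaining tail injective.\<close>

lemma exchange_step_exists:
  assumes prev: "\<And>j. lt j i \<Longrightarrow> exchange_step e j (e j)"
  shows "\<exists>r. exchange_step e i r"
proof -
  let ?S = "{j. lt j i}" and ?S' = "{j. lt j i \<or> j = i}"
  have adm: "admissible e j (e j)" if "j \<in> ?S" for j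
    using that prev by (simp add: exchange_step_def)
  have inj: "z = 0" if "\<And>j. j \<in> ?S \<Longrightarrow> e j * z = 0" "part (- ?S) * z = 0" for z
    using segment_injective[of ?S e z] that prev lt_trans by blast
  obtain p c where p: "p * p = p" and "\<forall>z. p * z = z \<longleftrightarrow> (\<forall>j\<in>?S. e j * z = 0)"
    and c: "p * c = c" "c * part (- ?S) * p = p"
    by (rule segment_inverse[OF adm inj])
  then have ker: "p * z = z \<longleftrightarrow> (\<forall>j\<in>?S. e j * z = 0)" for z by blast
  have "- ?S = {i} \<union> {k. lt i k}" using lt_total lt_trans lt_irrefl by blast
  then have tail: "part (- ?S) = x i + part {k. lt i k}"
    using part_Un[of "{i}" "{k. lt i k}"] lt_irrefl by (simp add: part_singleton)
  define a where "a = c * x i * p"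
  have "p * a = a" using c(1) by (simp add: a_def mult.assoc[symmetric])
  moreover have "a * p = a" by (simp add: a_def mult.assoc p)
  ultimately obtain g s where g: "g * g = g" and pg: "p * g = g" and gs: "g = s * a"
    and fixed: "\<And>z. a * z = z \<Longrightarrow> g * z = 0 \<Longrightarrow> z = 0"
    using corner_idempotent[OF semi p] by blast
  \<comment> \<open>\<open>g = s * a\<close> ends in \<open>x i * p\<close>. Dropping that
    \<open>p\<close> gives an element of \<open>R x i\<close> with the same action on
    \<open>p R\<close>; the leading \<open>g\<close> keeps its values in \<open>p R\<close>.\<close>
  define r where "r = g * s * c * x i"
  have "r * p = g * (s * a)" by (simp add: r_def a_def mult.assoc)
  then have rp: "r * p = g" using g gs by simp
  have gr: "g * r = r" by (simp add: r_def mult.assoc[symmetric] g)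
  have pr: "p * r = r" by (simp add: r_def mult.assoc[symmetric] pg)
  have rg: "r * g = g"
  proof -
    have "r * g = (r * p) * g" by (simp add: mult.assoc pg)
    then show ?thesis by (simp add: rp g)
  qed
  have "r * r = (r * g) * r" by (simp add: mult.assoc gr)
  then have rr: "r * r = r" by (simp add: rg gr)
  have er: "e j * r = 0" if "lt j i" for j using ker[of r] pr that by blast
  have r: "admissible e i r" using rr er by (auto simp: admissible_def r_def)
  \<comment> \<open>The segment lemmas are now applied up to and including \<open>i\<close>.\<close>
  let ?e = "e(i := r)"
  have adm': "admissible ?e j (?e j)" if "j \<in> ?S'" for j
  proof (cases "j = i")
    case True
    then show ?thesis using r lt_irrefl by (auto simp: admissible_def)
  next
    case False
    then have "lt j i" using that by blast
    moreover have "k \<noteq> i" if "lt k j" for k using that \<open>lt j i\<close> lt_trans lt_irrefl by blast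
    ultimately show ?thesis using adm[of j] False by (auto simp: admissible_def)
  qed
  have inj': "z = 0" if ez: "\<And>j. j \<in> ?S' \<Longrightarrow> ?e j * z = 0" and tz: "part {k. lt i k} * z = 0" for z
  proof -
    have "e j * z = 0" if "lt j i" for j
      using ez[of j] that lt_irrefl by (cases "j = i") auto
    then have pz: "p * z = z" using ker[of z] by blast
    have "c * part (- ?S) * p * z = z" using c(2) pz by simp
    then have "c * (x i * (p * z) + part {k. lt i k} * (p * z)) = z"
      by (simp add: tail mult.assoc distrib_right)
    then have "a * z = z" using tz pz by (simp add: a_def mult.assoc)
    moreover have "g * z = 0" using ez[of i] pz by (simp add: rp[symmetric] mult.assoc)
    ultimately show ?thesis by (rule fixed)
  qed
  obtain p' c' where "p' * p' = p'"
    and ker': "\<forall>z. p' * z = z \<longleftrightarrow> (\<forall>j\<in>?S'. ?e j * z = 0)"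
    and "p' * c' = c'" and c': "c' * part {k. lt i k} * p' = p'"
    by (rule segment_inverse[OF adm' inj'])
  have "c' * (part {k. lt i k} * z) = z" if ez: "\<forall>j. lt j i \<longrightarrow> e j * z = 0" and rz: "r * z = 0" for z
  proof -
    have "p' * z = z" using spec[OF ker', of z] ez rz lt_irrefl by auto
    then have "c' * (part {k. lt i k} * z) = c' * part {k. lt i k} * p' * z"
      by (simp add: mult.assoc)
    then show ?thesis using c' \<open>p' * z = z\<close> by simp
  qed
  then have "exchange_step e i r" using r by (auto simp: exchange_step_def)
  then show ?thesis ..
qed

text \<open>Once all idempotents are chosen, their sum \<open>u\<close> is a unit with inverse
  \<open>w\<close>. Left multiplication by \<open>w\<close> normalizes the sum to \<open>1\<close>,
  stays in each \<open>R x i\<close>, and supplies the missing half of orthogonality.\<close>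

lemma exchange_idempotents:
  obtains e where "\<And>i. \<exists>q. e i = q * x i" and "\<And>i j. e i * e j = (if i = j then e i else 0)"
    and "sums e 1"
proof -
  have "\<exists>e. \<forall>i. exchange_step e i (e i)"
  proof (rule dependent_wf_choice)
    show "wf {(i, j). lt i j}" using lt_wf by (simp add: wfp_def)
  next
    fix e g :: "'i \<Rightarrow> 'a" and i r
    assume "\<And>j. (j, i) \<in> {(i, j). lt i j} \<Longrightarrow> e j = g j"
    then have "\<And>j. lt j i \<Longrightarrow> e j = g j" by simp
    then show "exchange_step e i r = exchange_step g i r"
      by (simp add: exchange_step_def admissible_def cong: imp_cong)
  next
    fix i and e :: "'i \<Rightarrow> 'a"
    assume "\<And>j. (j, i) \<in> {(i, j). lt i j} \<Longrightarrow> exchange_step e j (e j)"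
    then show "\<exists>r. exchange_step e i r" by (intro exchange_step_exists) simp
  qed
  then obtain e where e: "\<And>i. exchange_step e i (e i)" by blast
  then have adm: "admissible e i (e i)" for i by (simp add: exchange_step_def)
  obtain p u w where p: "p * p = p" "\<forall>z. p * z = z \<longleftrightarrow> (\<forall>i\<in>UNIV. e i * z = 0)"
    and "sums (\<lambda>i. if i \<in> UNIV then e i else 0) u" and w: "w * u = 1 - p"
    by (rule segment_complement[OF adm])
  then have u: "sums e u" by simp
  \<comment> \<open>For the full segment the remaining tail is the empty sum, so injectivity applies
    to \<open>p\<close> itself.\<close>
  have "p = 0"
    by (rule segment_injective[of UNIV e]) (use e p in \<open>auto simp: part_empty\<close>)
  then have wu: "w * u = 1" using w by simp
  then have uw: "u * w = 1" using df by (simp add: dedekind_finite_def)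
  have tri: "triangular e" using adm by (simp add: triangular_def admissible_def)
  have ewe: "e i * (w * e k) = (if i = k then e i else 0)" for i k
  proof -
    \<comment> \<open>Since \<open>u * w = 1\<close>, the family \<open>e i * (w * e k)\<close> and
      the one with single entry \<open>e k\<close> at \<open>k\<close> both sum to
      \<open>e k\<close>; their difference solves the triangular system with right-hand side
      \<open>0\<close>.\<close>
    define D where "D = (\<lambda>i. e i * (w * e k) - (if i = k then e k else 0))"
    have "sums D (u * (w * e k) - e k)"
      unfolding D_def by (rule sums_diff[OF sums_mult_right[OF u] sums_single])
    then have "sums D 0" by (simp add: mult.assoc[symmetric] uw)
    moreover have "e i * D i = D i" for i
      using tri by (simp add: D_def triangular_def right_diff_distrib mult.assoc[symmetric])
    ultimately have "D i \<in> {0}" by (rule triangular_solve[OF tri closed_left_ideal_zero]) simp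
    then show ?thesis by (simp add: D_def split: if_splits)
  qed
  show ?thesis
  proof (rule that[of "\<lambda>i. w * e i"])
    show "\<exists>q. w * e i = q * x i" for i
    proof -
      obtain q where "e i = q * x i" using adm[of i] by (auto simp: admissible_def)
      then have "w * e i = (w * q) * x i" by (simp add: mult.assoc)
      then show ?thesis ..
    qed
    show "w * e i * (w * e j) = (if i = j then w * e i else 0)" for i j
      by (simp add: mult.assoc ewe)
    show "sums (\<lambda>i. w * e i) 1" using sums_mult_left[OF u, of w] by (simp add: wu)
  qed
qed

end

section \<open>From the whole index type to arbitrary index sets\<close>

lemma sums_to_extend_zero:
  "sums_to \<U> I x r \<longleftrightarrow> sums_to \<U> UNIV (\<lambda>i. if i \<in> I then x i else 0) r"
proof -
  let ?y = "\<lambda>i. if i \<in> I then x i else 0"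
  have y: "sum ?y F = sum x (F \<inter> I)" if "finite F" for F
    using that by (simp add: sum.inter_restrict)
  show ?thesis
    unfolding sums_to_def
  proof (rule ball_cong[OF refl], rule iffI)
    fix U
    assume "\<exists>F'. finite F' \<and> F' \<subseteq> I \<and>
      (\<forall>F. finite F \<and> F' \<subseteq> F \<and> F \<subseteq> I \<longrightarrow> sum x F - r \<in> U)"
    then obtain F' where F': "finite F'" "F' \<subseteq> I"
      "\<forall>F. finite F \<and> F' \<subseteq> F \<and> F \<subseteq> I \<longrightarrow> sum x F - r \<in> U" by (elim exE conjE)
    have "sum ?y F - r \<in> U" if "finite F" "F' \<subseteq> F" for F
      using F'(2) spec[OF F'(3), of "F \<inter> I"] that by (simp add: y)
    then show "\<exists>F'. finite F' \<and> F' \<subseteq> UNIV \<and>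
      (\<forall>F. finite F \<and> F' \<subseteq> F \<and> F \<subseteq> UNIV \<longrightarrow> sum ?y F - r \<in> U)"
      using F'(1) by (intro exI[of _ F']) simp
  next
    fix U
    assume "\<exists>F'. finite F' \<and> F' \<subseteq> UNIV \<and>
      (\<forall>F. finite F \<and> F' \<subseteq> F \<and> F \<subseteq> UNIV \<longrightarrow> sum ?y F - r \<in> U)"
    then obtain F' where F': "finite F'"
      "\<forall>F. finite F \<and> F' \<subseteq> F \<and> F \<subseteq> UNIV \<longrightarrow> sum ?y F - r \<in> U" by (elim exE conjE)
    have "sum x F - r \<in> U" if F: "finite F" "F' \<inter> I \<subseteq> F" "F \<subseteq> I" for F
    proof -
      have "(F \<union> F') \<inter> I = F" using F by blast
      then have "sum ?y (F \<union> F') = sum x F" using y[of "F \<union> F'"] F(1) F'(1) by simp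
      then show ?thesis using spec[OF F'(2), of "F \<union> F'"] F(1) F'(1) by simp
    qed
    then show "\<exists>F'. finite F' \<and> F' \<subseteq> I \<and>
      (\<forall>F. finite F \<and> F' \<subseteq> F \<and> F \<subseteq> I \<longrightarrow> sum x F - r \<in> U)"
      using F'(1) by (intro exI[of _ "F' \<inter> I"]) simp
  qed
qed

theorem theorem4:
  fixes \<U> :: "'a::ring_1 set set"
  assumes "nice_topology \<U> TYPE('i)"
    and "C2_RR TYPE('a)"
    and "dedekind_finite TYPE('a)"
    and "semi_pi_regular TYPE('a)"
  shows "full_exchange \<U> TYPE('i)"
  unfolding full_exchange_def exchange_for_def
proof (intro allI impI)
  fix I :: "'i set" and x :: "'i \<Rightarrow> 'a"
  assume "sums_to \<U> I x 1"
  then have sums_y: "sums_to \<U> UNIV (\<lambda>i. if i \<in> I then x i else 0) 1"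
    by (simp only: sums_to_extend_zero[symmetric])
  \<comment> \<open>Any well-order of the index type will do; it need not be related to
    \<open>I\<close>.\<close>
  obtain R :: "'i rel" where R: "well_order_on UNIV R" using well_order_on by blast
  define lt where "lt i j \<longleftrightarrow> (i, j) \<in> R - Id" for i j
  have wf: "wf (R - Id)" and tr: "trans R" and anti: "antisym R" and tot: "total R"
    using R by (auto simp: order_on_defs)
  interpret summable_partition \<U> lt "\<lambda>i. if i \<in> I then x i else 0"
  proof unfold_locales
    show "linear_hausdorff_basis \<U>" using assms(1) by (simp add: nice_topology_def)
    have "{(i, j). lt i j} = R - Id" by (auto simp: lt_def)
    then show "wfp lt" using wf by (simp add: wfp_def)
    show "lt i k" if "lt i j" "lt j k" for i j k
      using that tr anti unfolding lt_def by (auto dest: transD antisymD)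
    show "lt i j \<or> lt j i" if "i \<noteq> j" for i j
      using that tot by (auto simp: lt_def total_on_def)
    show "\<exists>s'. sums_to \<U> UNIV (\<lambda>i. r i * y i) s'" if "sums_to \<U> UNIV y s"
      for y :: "'i \<Rightarrow> 'a" and s r
    proof -
      have "summable_fam \<U> UNIV (\<lambda>i. r i * y i)"
        using assms(1) that unfolding nice_topology_def summable_fam_def by blast
      then show ?thesis by (simp add: summable_fam_def)
    qed
  qed (use sums_y assms in simp_all)
  obtain e where q: "\<And>i. \<exists>q. e i = q * (if i \<in> I then x i else 0)"
    and orth: "\<And>i j. e i * e j = (if i = j then e i else 0)" and sums_e: "sums e 1"
    by (rule exchange_idempotents) blast
  \<comment> \<open>Outside \<open>I\<close> the family entry is \<open>0\<close>, so
    \<open>e i\<close>, a left multiple of it, vanishes and restricting to \<open>I\<close> loses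
    nothing.\<close>
  have zero_off: "(\<lambda>i. if i \<in> I then e i else 0) = e"
  proof
    show "(if i \<in> I then e i else 0) = e i" for i using q[of i] by auto
  qed
  have "sums_to \<U> I e 1" unfolding sums_to_extend_zero[of \<U> I] zero_off by (rule sums_e)
  moreover have "\<exists>q. e i = q * x i" if "i \<in> I" for i using q[of i] that by simp
  ultimately show "\<exists>e. (\<forall>i\<in>I. e i * e i = e i \<and> (\<exists>r. e i = r * x i)) \<and>
      (\<forall>i\<in>I. \<forall>j\<in>I. i \<noteq> j \<longrightarrow> e i * e j = 0) \<and> sums_to \<U> I e 1"
    using orth by (intro exI[of _ e]) simp
qed

end
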